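(* Let $n\ge1$, let $0<\lambda\le n$, and let $Q$ be a probability distribution on $\mathbb{N}=\{1,2,\ldots\}$. Suppose that $Q$ and the compound binomial distribution $\mathrm{CBin}(n,\lambda/n,Q)$ are both log-concave, and that $Q$ satisfies at least one of the following: (a) $Q$ has finite support; or (b) for some $\rho,\beta>0$ and $N_0\ge1$, $Q(x)\ge\rho^{x^\beta}$ for all $x\ge N_0$. Then $$H(\mathrm{CBin}(n,\lambda/n,Q))=\max\Big\{H(C_Qb_{\mathbf p})\;:\;\mathbf p\in\mathcal P_n(\lambda)\Big\}.$$
   Context: $\mathbb{Z}_+=\{0,1,2,\ldots\}$, $\mathbb{N}=\{1,2,\ldots\}$. For a probability mass function $P$ on $\mathbb{Z}_+$, $H(P)=-\sum_x P(x)\log P(x)$ is the discrete entropy (natural logarithm, $0\log0=0$). A distribution $P$ on $\mathbb{Z}_+$ is log-concave if its support is a (possibly infinite) interval of successive integers and $P(x)^2\ge P(x+1)P(x-1)$ for all $x\ge1$; a distribution on $\mathbb{N}$ is regarded as one on $\mathbb{Z}_+$ with zero mass at $0$. For $\mathbf p=(p_1,\ldots,p_n)\in[0,1]^n$, $b_{\mathbf p}$ is the law of $\sum_{i=1}^nB_i$ with $B_i\sim\mathrm{Bern}(p_i)$ independent. $\mathcal P_n(\lambda)=\{\mathbf p\in[0,1]^n: p_1+\cdots+p_n=\lambda\}$. For $P$ on $\mathbb{Z}_+$ and $Q$ on $\mathbb{N}$, the $Q$-compound distribution is $C_QP(x)=\sum_{y\ge0}P(y)Q^{*y}(x)$, $x\ge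 0$, where $Q^{*y}$ is the $y$-fold convolution power of $Q$ and $Q^{*0}$ is the point mass at $0$. The compound binomial distribution $\mathrm{CBin}(n,p,Q)$ is $C_Qb_{\mathbf p}$ with $\mathbf p=(p,\ldots,p)\in[0,1]^n$, i.e. $C_Q$ applied to the binomial distribution $\mathrm{Bin}(n,p)$. *)

theory Defs
  imports "HOL-Probability.Probability"
begin

text \<open>
  Probability distributions on the nonnegative integers are elements of \<^typ>\<open>nat pmf\<close>;
  a distribution \<open>Q\<close> on the positive integers is one with \<open>pmf Q 0 = 0\<close>.
\<close>

text \<open>
  Discrete entropy in nats. All summands are nonnegative, so the series is taken in
  \<^typ>\<open>ennreal\<close> and an infinite entropy has the value \<open>\<infinity>\<close> rather than a junk value.
  The convention \<open>0 log 0 = 0\<close> holds because the factor \<open>pmf P x\<close> vanishes.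
\<close>

definition pmf_entropy :: "nat pmf \<Rightarrow> ennreal" where
  "pmf_entropy P = (\<Sum>x. ennreal (- (pmf P x * ln (pmf P x))))"

definition log_concave_pmf :: "nat pmf \<Rightarrow> bool" where
  "log_concave_pmf P \<longleftrightarrow>
     (\<forall>a\<in>set_pmf P. \<forall>c\<in>set_pmf P. {a..c} \<subseteq> set_pmf P) \<and>
     (\<forall>x\<ge>1. (pmf P x)\<^sup>2 \<ge> pmf P (x + 1) * pmf P (x - 1))"

text \<open>A vector \<open>p\<close> in \<open>[0,1]\<^sup>n\<close> is a function of which only the values on \<open>{1..n}\<close> are used.\<close>

definition bernoulli_sum_pmf :: "nat \<Rightarrow> (nat \<Rightarrow> real) \<Rightarrow> nat pmf" where
  "bernoulli_sum_pmf n p =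
     map_pmf (\<lambda>B. \<Sum>i=1..n. of_bool (B i)) (Pi_pmf {1..n} False (\<lambda>i. bernoulli_pmf (p i)))"

definition success_vectors :: "nat \<Rightarrow> real \<Rightarrow> (nat \<Rightarrow> real) set" where
  "success_vectors n lam = {p. (\<forall>i\<in>{1..n}. 0 \<le> p i \<and> p i \<le> 1) \<and> (\<Sum>i=1..n. p i) = lam}"

primrec conv_power_pmf :: "nat pmf \<Rightarrow> nat \<Rightarrow> nat pmf" where
  "conv_power_pmf Q 0 = return_pmf 0"
| "conv_power_pmf Q (Suc y) = map_pmf (\<lambda>(a, b). a + b) (pair_pmf Q (conv_power_pmf Q y))"

definition compound_pmf :: "nat pmf \<Rightarrow> nat pmf \<Rightarrow> nat pmf" where
  "compound_pmf Q P = bind_pmf P (conv_power_pmf Q)"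

definition compound_binomial_pmf :: "nat \<Rightarrow> real \<Rightarrow> nat pmf \<Rightarrow> nat pmf" where
  "compound_binomial_pmf n p Q = compound_pmf Q (bernoulli_sum_pmf n (\<lambda>_. p))"

text \<open>The series formula for the \<open>Q\<close>-compound distribution.\<close>

lemma pmf_compound_pmf:
  "(\<lambda>y. pmf P y * pmf (conv_power_pmf Q y) x) sums pmf (compound_pmf Q P) x"
proof -
  have "ennreal (pmf (compound_pmf Q P) x) =
      (\<integral>\<^sup>+y. ennreal (pmf (conv_power_pmf Q y) x) \<partial>measure_pmf P)"
    by (simp add: compound_pmf_def ennreal_pmf_bind)
  also have "\<dots> = (\<Sum>y. ennreal (pmf P y * pmf (conv_power_pmf Q y) x))"
    by (simp add: nn_integral_measure_pmf nn_integral_count_space_nat ennreal_mult)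
  finally have *: "(\<Sum>y. ennreal (pmf P y * pmf (conv_power_pmf Q y) x)) =
      ennreal (pmf (compound_pmf Q P) x)" ..
  have "(\<lambda>y. ennreal (pmf P y * pmf (conv_power_pmf Q y) x)) sums
      ennreal (pmf (compound_pmf Q P) x)"
    unfolding * [symmetric] by (rule summable_sums) simp
  then show ?thesis
    by (subst (asm) sums_ennreal) auto
qed

lemma bernoulli_sum_pmf_const:
  assumes "0 \<le> p" "p \<le> 1"
  shows "bernoulli_sum_pmf n (\<lambda>_. p) = binomial_pmf n p"
proof -
  have "(\<Sum>i=1..n. of_bool (B i)) = card {i\<in>{1..n}. B i}" for B :: "nat \<Rightarrow> bool"
    by (simp add: sum.If_cases of_bool_def Int_def)
  then show ?thesis
    unfolding bernoulli_sum_pmf_def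
    using binomial_pmf_altdef'[of "{1..n}" n p False] assms by simp
qed

end

theory Submission
  imports Defs
begin

text \<open>
  Write \<open>R\<close> for the compound binomial law, \<open>P = C\<^sub>Q b\<^sub>p\<close> for a competitor, and let \<open>f = - ln R\<close>,
  with value \<open>\<infinity>\<close> off the support of \<open>R\<close>. Gibbs' inequality says \<open>H(P) \<le> E\<^sub>P f\<close>, with equality for
  \<open>P = R\<close>. So the theorem follows once \<open>E\<^sub>P f \<le> E\<^sub>R f\<close>, and this is an instance of a convex ordering:
  log-concavity of \<open>R\<close> means exactly that \<open>f\<close> is convex.

  The ordering is reduced to Bernoulli sums by conditioning on the number \<open>y\<close> of summands. If
  \<open>S\<^sub>y\<close> is a sum of \<open>y\<close> independent variables of law \<open>Q\<close>, then \<open>g(y) = E f(S\<^sub>y)\<close> is again convex: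
  adding two further nonnegative summands \<open>a\<close>, \<open>b\<close> to \<open>s = S\<^sub>y\<close>, convexity of \<open>f\<close> gives
  \<open>f(s + a) + f(s + b) \<le> f(s) + f(s + a + b)\<close>, and the two terms on the left have the same mean
  (lemma \<open>compound_mean_convex\<close>).

  It remains to see that among Bernoulli sums with given mean the binomial law maximises the
  expectation of a convex \<open>g\<close>, which is Hoeffding's theorem. Given the other variables, the
  expectation depends on two parameters \<open>p\<close>, \<open>q\<close> of fixed sum only through their product, with
  the nonnegative coefficient \<open>g(s) - 2 g(s + 1) + g(s + 2)\<close>. Hence moving a pair of parameters that
  lies on either side of the mean \<open>m\<close> towards each other, until one of them equals \<open>m\<close>, does not
  decrease the expectation, and finitely many such moves make all parameters equal
  (lemma \<open>bernoulli_sum_mean_le_equal\<close>).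

  All expectations are taken in the extended nonnegative reals, so that no integrability question
  arises and infinite entropies need no separate treatment.
\<close>

section \<open>Log-concave distributions and Gibbs' inequality\<close>

text \<open>
  The ratios \<open>pmf P (k + 1) / pmf P k\<close> decrease along the support. Since the support is an
  interval, no factor that is cancelled below vanishes unless the left-hand side does.
\<close>

lemma log_concave_pmf_mult_le:
  assumes lc: "log_concave_pmf P"
  shows "pmf P x * pmf P (x + a + b) \<le> pmf P (x + a) * pmf P (x + b)"
proof -
  have pos: "pmf P k > 0" if "pmf P i > 0" "pmf P j > 0" "i \<le> k" "k \<le> j" for i j k
    using lc that unfolding log_concave_pmf_def pmf_positive_iff
    by (meson atLeastAtMost_iff subsetD)
  have lc': "pmf P k * pmf P (k + 2) \<le> (pmf P (k + 1))\<^sup>2" for k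
    using lc unfolding log_concave_pmf_def
    by (auto dest!: spec[of _ "k + 1"] simp: mult.commute)
  have step: "pmf P x * pmf P (x + a + 1) \<le> pmf P (x + 1) * pmf P (x + a)" for x a
  proof (induction a)
    case (Suc a)
    show ?case
    proof (cases "pmf P x > 0 \<and> pmf P (x + Suc a + 1) > 0")
      case True
      then have p: "pmf P (x + a) > 0" "pmf P (x + a + 1) > 0"
        using pos[of x "x + Suc a + 1" "x + a"] pos[of x "x + Suc a + 1" "x + a + 1"] by auto
      have "pmf P (x + a) * (pmf P x * pmf P (x + a + 2))
          = pmf P x * (pmf P (x + a) * pmf P (x + a + 2))"
        by simp
      also have "\<dots> \<le> pmf P x * (pmf P (x + a + 1))\<^sup>2"
        by (intro mult_left_mono lc') auto
      also have "\<dots> = pmf P (x + a + 1) * (pmf P x * pmf P (x + a + 1))"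
        by (simp add: power2_eq_square)
      also have "\<dots> \<le> pmf P (x + a + 1) * (pmf P (x + 1) * pmf P (x + a))"
        by (intro mult_left_mono Suc.IH) auto
      also have "\<dots> = pmf P (x + a) * (pmf P (x + 1) * pmf P (x + a + 1))"
        by simp
      finally show ?thesis
        using p by (simp add: mult_le_cancel_left_pos)
    next
      case False
      then have "pmf P x = 0 \<or> pmf P (x + Suc a + 1) = 0"
        by (simp add: less_le)
      then show ?thesis by auto
    qed
  qed simp
  show ?thesis
  proof (induction b)
    case (Suc b)
    show ?case
    proof (cases "pmf P x > 0 \<and> pmf P (x + a + Suc b) > 0")
      case True
      then have p: "pmf P (x + b) > 0" "pmf P (x + a + b) > 0"
        using pos[of x "x + a + Suc b" "x + b"] pos[of x "x + a + Suc b" "x + a + b"] by auto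
      have "(pmf P x * pmf P (x + a + b)) * (pmf P (x + b) * pmf P (x + b + a + 1))
          \<le> (pmf P (x + a) * pmf P (x + b)) * (pmf P (x + b + 1) * pmf P (x + b + a))"
        by (intro mult_mono Suc.IH step) auto
      then have "(pmf P (x + b) * pmf P (x + a + b)) * (pmf P x * pmf P (x + a + Suc b))
          \<le> (pmf P (x + b) * pmf P (x + a + b)) * (pmf P (x + a) * pmf P (x + Suc b))"
        by (simp add: ac_simps)
      then show ?thesis
        using p by (simp add: mult_le_cancel_left_pos)
    next
      case False
      then have "pmf P x = 0 \<or> pmf P (x + a + Suc b) = 0"
        by (simp add: less_le)
      then show ?thesis by auto
    qed
  qed simp
qed

definition neg_log_pmf :: "nat pmf \<Rightarrow> nat \<Rightarrow> ennreal" where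
  "neg_log_pmf R x = (if pmf R x = 0 then \<infinity> else ennreal (- ln (pmf R x)))"

lemma neg_log_pmf_convex:
  assumes "log_concave_pmf R"
  shows "neg_log_pmf R (x + a) + neg_log_pmf R (x + b)
    \<le> neg_log_pmf R x + neg_log_pmf R (x + a + b)"
proof (cases "pmf R x = 0 \<or> pmf R (x + a + b) = 0")
  case True
  then show ?thesis by (auto simp: neg_log_pmf_def)
next
  case False
  then have pos: "pmf R x > 0" "pmf R (x + a + b) > 0"
    by (simp_all add: less_le)
  have le: "pmf R x * pmf R (x + a + b) \<le> pmf R (x + a) * pmf R (x + b)"
    by (rule log_concave_pmf_mult_le[OF assms])
  moreover have "pmf R x * pmf R (x + a + b) > 0"
    using pos by simp
  ultimately have "pmf R (x + a) * pmf R (x + b) > 0"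
    by linarith
  then have pos': "pmf R (x + a) > 0" "pmf R (x + b) > 0"
    by (simp_all add: zero_less_mult_iff less_le)
  have nonneg: "- ln (pmf R k) \<ge> 0" if "pmf R k > 0" for k
    using that by (simp add: pmf_le_1)
  have "ln (pmf R x * pmf R (x + a + b)) \<le> ln (pmf R (x + a) * pmf R (x + b))"
    using pos le by (intro ln_mono) auto
  then have "- ln (pmf R (x + a)) + - ln (pmf R (x + b))
      \<le> - ln (pmf R x) + - ln (pmf R (x + a + b))"
    using pos pos' by (simp add: ln_mult_pos)
  then have "ennreal (- ln (pmf R (x + a)) + - ln (pmf R (x + b)))
      \<le> ennreal (- ln (pmf R x) + - ln (pmf R (x + a + b)))"
    by (rule ennreal_leI)
  then show ?thesis
    using pos pos' nonneg by (simp add: neg_log_pmf_def ennreal_plus[symmetric] del: ennreal_plus)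
qed

lemma nn_integral_pmf_nat:
  fixes P :: "nat pmf"
  shows "(\<integral>\<^sup>+x. f x \<partial>measure_pmf P) = (\<Sum>x. ennreal (pmf P x) * f x)"
  by (simp add: nn_integral_measure_pmf nn_integral_count_space_nat)

lemma pmf_entropy_eq_mean_neg_log:
  "pmf_entropy R = (\<integral>\<^sup>+x. neg_log_pmf R x \<partial>measure_pmf R)"
proof -
  have "ennreal (- (pmf R x * ln (pmf R x))) = ennreal (pmf R x) * neg_log_pmf R x" for x
    by (auto simp: neg_log_pmf_def ennreal_mult'[symmetric])
  then show ?thesis
    by (simp add: pmf_entropy_def nn_integral_pmf_nat)
qed

text \<open>
  Gibbs' inequality. The pointwise bound \<open>P ln (R / P) \<le> R - P\<close> is used with both total masses
  kept on the same side as the nonnegative terms, so that only the finite constant 1 has to be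
  cancelled after summation.
\<close>

lemma pmf_entropy_le_mean_neg_log:
  "pmf_entropy P \<le> (\<integral>\<^sup>+x. neg_log_pmf R x \<partial>measure_pmf P)"
proof -
  have pointwise: "ennreal (- (pmf P x * ln (pmf P x))) + ennreal (pmf P x)
      \<le> ennreal (pmf P x) * neg_log_pmf R x + ennreal (pmf R x)" for x
  proof (cases "pmf P x = 0")
    case False
    then have P: "pmf P x > 0" by (simp add: less_le)
    show ?thesis
    proof (cases "pmf R x = 0")
      case True
      then show ?thesis using P by (simp add: neg_log_pmf_def ennreal_mult_top)
    next
      case False
      then have R: "pmf R x > 0" by (simp add: less_le)
      have "ln (pmf R x / pmf P x) \<le> pmf R x / pmf P x - 1"
        using P R by (intro ln_le_minus_one) simp
      then have "pmf P x * ln (pmf R x / pmf P x) \<le> pmf P x * (pmf R x / pmf P x - 1)"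
        using P by (intro mult_left_mono) auto
      then have real_ineq: "- (pmf P x * ln (pmf P x)) + pmf P x
          \<le> pmf P x * (- ln (pmf R x)) + pmf R x"
        using P R by (simp add: ln_div right_diff_distrib)
      have "pmf P x * ln (pmf P x) \<le> 0" "pmf P x * ln (pmf R x) \<le> 0"
        using P R by (auto simp: mult_le_0_iff pmf_le_1)
      then show ?thesis
        using P R ennreal_leI[OF real_ineq]
        by (simp add: neg_log_pmf_def ennreal_mult'[symmetric] ennreal_plus[symmetric]
            del: ennreal_plus)
    qed
  qed simp
  have mass: "(\<Sum>x. ennreal (pmf S x)) = 1" for S :: "nat pmf"
    using nn_integral_pmf_nat[where f = "\<lambda>_. 1" and P = S] by simp
  have "pmf_entropy P + 1
      = (\<Sum>x. ennreal (- (pmf P x * ln (pmf P x))) + ennreal (pmf P x))"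
    by (simp add: pmf_entropy_def suminf_add[symmetric] mass)
  also have "\<dots> \<le> (\<Sum>x. ennreal (pmf P x) * neg_log_pmf R x + ennreal (pmf R x))"
    by (intro suminf_le pointwise) auto
  also have "\<dots> = (\<integral>\<^sup>+x. neg_log_pmf R x \<partial>measure_pmf P) + 1"
    by (simp add: nn_integral_pmf_nat suminf_add[symmetric] mass)
  finally show ?thesis
    by (simp add: add.commute[of _ 1] ennreal_add_left_cancel_le)
qed

section \<open>Compounding preserves convexity\<close>

lemma nn_integral_conv_power_Suc:
  "(\<integral>\<^sup>+x. f x \<partial>measure_pmf (conv_power_pmf Q (Suc y)))
    = (\<integral>\<^sup>+a. \<integral>\<^sup>+s. f (s + a) \<partial>measure_pmf (conv_power_pmf Q y) \<partial>measure_pmf Q)"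
  by (simp add: nn_integral_pair_pmf' add.commute)

text \<open>
  Because the summands are nonnegative, convexity of \<open>f\<close> for arbitrary increments \<open>a\<close>, \<open>b\<close> turns
  into nonnegativity of the second difference of the mean in the number of summands.
\<close>

lemma compound_mean_convex:
  fixes f :: "nat \<Rightarrow> ennreal" and Q :: "nat pmf"
  defines "g \<equiv> \<lambda>y. \<integral>\<^sup>+x. f x \<partial>measure_pmf (conv_power_pmf Q y)"
  assumes convex: "\<And>x a b. f (x + a) + f (x + b) \<le> f x + f (x + a + b)"
  shows "2 * g (y + 1) \<le> g y + g (y + 2)"
proof -
  let ?S = "measure_pmf (conv_power_pmf Q y)" and ?Q = "measure_pmf Q"
  have g1: "g (y + 1) = (\<integral>\<^sup>+a. \<integral>\<^sup>+s. f (s + a) \<partial>?S \<partial>?Q)"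
    unfolding g_def using nn_integral_conv_power_Suc[where f = f and Q = Q and y = y] by simp
  have g2: "g (y + 2) = (\<integral>\<^sup>+a. \<integral>\<^sup>+b. \<integral>\<^sup>+s. f (s + a + b) \<partial>?S \<partial>?Q \<partial>?Q)"
  proof -
    have "g (y + 2) = (\<integral>\<^sup>+a. \<integral>\<^sup>+t. f (t + a) \<partial>measure_pmf (conv_power_pmf Q (Suc y)) \<partial>?Q)"
      unfolding g_def using nn_integral_conv_power_Suc[where f = f and Q = Q and y = "Suc y"] by simp
    also have "\<dots> = (\<integral>\<^sup>+a. \<integral>\<^sup>+b. \<integral>\<^sup>+s. f (s + b + a) \<partial>?S \<partial>?Q \<partial>?Q)"
      by (simp only: nn_integral_conv_power_Suc)
    finally show ?thesis by (simp add: ac_simps)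
  qed
  have "2 * g (y + 1) = (\<integral>\<^sup>+a. \<integral>\<^sup>+b. \<integral>\<^sup>+s. f (s + a) + f (s + b) \<partial>?S \<partial>?Q \<partial>?Q)"
    unfolding mult_2 g1 by (simp add: nn_integral_add)
  also have "\<dots> \<le> (\<integral>\<^sup>+a. \<integral>\<^sup>+b. \<integral>\<^sup>+s. f s + f (s + a + b) \<partial>?S \<partial>?Q \<partial>?Q)"
    by (intro nn_integral_mono convex)
  also have "\<dots> = g y + g (y + 2)"
    unfolding g2 by (simp add: nn_integral_add g_def del: conv_power_pmf.simps)
  finally show ?thesis .
qed

lemma nn_integral_compound_pmf:
  "(\<integral>\<^sup>+x. f x \<partial>measure_pmf (compound_pmf Q P))
    = (\<integral>\<^sup>+y. \<integral>\<^sup>+x. f x \<partial>measure_pmf (conv_power_pmf Q y) \<partial>measure_pmf P)"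
  by (simp add: compound_pmf_def nn_integral_bind_pmf)

section \<open>Hoeffding's comparison for Bernoulli sums\<close>

definition bernoulli_sum_mean :: "(nat \<Rightarrow> ennreal) \<Rightarrow> 'a set \<Rightarrow> ('a \<Rightarrow> real) \<Rightarrow> ennreal" where
  "bernoulli_sum_mean g A p =
    (\<integral>\<^sup>+B. g (\<Sum>i\<in>A. of_bool (B i)) \<partial>measure_pmf (Pi_pmf A False (\<lambda>i. bernoulli_pmf (p i))))"

lemma bernoulli_sum_mean_cong:
  assumes "finite A" "\<And>i. i \<in> A \<Longrightarrow> p i = q i"
  shows "bernoulli_sum_mean g A p = bernoulli_sum_mean g A q"
proof -
  have "Pi_pmf A False (\<lambda>i. bernoulli_pmf (p i)) = Pi_pmf A False (\<lambda>i. bernoulli_pmf (q i))"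
    using assms by (intro Pi_pmf_cong) auto
  then show ?thesis by (simp add: bernoulli_sum_mean_def)
qed

lemma bernoulli_sum_mean_insert:
  assumes "finite A" "i \<notin> A" "0 \<le> p i" "p i \<le> 1"
  shows "bernoulli_sum_mean g (insert i A) p
    = ennreal (p i) * bernoulli_sum_mean (\<lambda>s. g (s + 1)) A p
    + ennreal (1 - p i) * bernoulli_sum_mean g A p"
proof -
  have upd: "(\<Sum>j\<in>A. of_bool ((B(i := c)) j)) = (\<Sum>j\<in>A. of_bool (B j) :: nat)" for B c
    using assms(2) by (intro sum.cong) auto
  have new: "of_bool ((B(i := c)) i) = (of_bool c :: nat)" for B c
    by simp
  show ?thesis
    using assms
    by (simp add: bernoulli_sum_mean_def Pi_pmf_insert nn_integral_pair_pmf' upd new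
        case_prod_unfold mult.commute add.commute del: fun_upd_apply sum_of_bool_eq)
qed

text \<open>
  Passing from \<open>(p, q)\<close> to \<open>(p', q')\<close> with the same sum adds \<open>p' q' - p q\<close> to the probabilities of 0
  and of 2 successes and takes twice that amount from the probability of 1 success.
\<close>

lemma two_bernoulli_mean_mono:
  fixes x0 x1 x2 :: ennreal and p q p' q' :: real
  assumes convex: "2 * x1 \<le> x0 + x2"
    and bounds: "0 \<le> p" "p \<le> 1" "0 \<le> q" "q \<le> 1" "0 \<le> p'" "p' \<le> 1" "0 \<le> q'" "q' \<le> 1"
    and sum: "p + q = p' + q'" and prod: "p * q \<le> p' * q'"
  shows "ennreal p * (ennreal q * x2 + ennreal (1 - q) * x1)
      + ennreal (1 - p) * (ennreal q * x1 + ennreal (1 - q) * x0)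
    \<le> ennreal p' * (ennreal q' * x2 + ennreal (1 - q') * x1)
      + ennreal (1 - p') * (ennreal q' * x1 + ennreal (1 - q') * x0)"
proof -
  define d where "d = p' * q' - p * q"
  define c where "c = p' * (1 - q') + (1 - p') * q'"
  have d: "0 \<le> d" and c: "0 \<le> c"
    using prod bounds by (simp_all add: d_def c_def)
  have group: "ennreal u * (ennreal v * x2 + ennreal (1 - v) * x1)
      + ennreal (1 - u) * (ennreal v * x1 + ennreal (1 - v) * x0)
    = ennreal (u * v) * x2 + ennreal (u * (1 - v) + (1 - u) * v) * x1
      + ennreal ((1 - u) * (1 - v)) * x0"
    if "0 \<le> u" "u \<le> 1" "0 \<le> v" "v \<le> 1" for u v :: real
    using that by (simp add: ennreal_mult ennreal_plus distrib_left distrib_right ac_simps)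
  have q: "q = p' + q' - p" using sum by simp
  have mid: "p * (1 - q) + (1 - p) * q = c + 2 * d"
    by (simp add: c_def d_def q algebra_simps)
  have top: "p' * q' = p * q + d"
    by (simp add: d_def)
  have bot: "(1 - p') * (1 - q') = (1 - p) * (1 - q) + d"
    by (simp add: d_def q algebra_simps)
  let ?base = "ennreal (p * q) * x2 + ennreal c * x1 + ennreal ((1 - p) * (1 - q)) * x0"
  have "ennreal (p * q) * x2 + ennreal (c + 2 * d) * x1 + ennreal ((1 - p) * (1 - q)) * x0
      = ?base + ennreal d * (2 * x1)"
    using c d by (simp add: ennreal_plus ennreal_mult distrib_left distrib_right ac_simps)
  also have "\<dots> \<le> ?base + ennreal d * (x0 + x2)"
    by (intro add_left_mono mult_left_mono convex) simp
  also have "\<dots> = ennreal (p * q + d) * x2 + ennreal c * x1 + ennreal ((1 - p) * (1 - q) + d) * x0"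
    using c d bounds by (simp add: ennreal_plus distrib_left distrib_right ac_simps)
  finally show ?thesis
    using bounds by (simp only: group mid top bot c_def[symmetric])
qed

lemma bernoulli_sum_mean_convex:
  assumes "\<And>y. 2 * g (y + 1) \<le> g y + g (y + 2)"
  shows "2 * bernoulli_sum_mean (\<lambda>s. g (s + 1)) A p
    \<le> bernoulli_sum_mean g A p + bernoulli_sum_mean (\<lambda>s. g (s + 2)) A p"
proof -
  let ?M = "measure_pmf (Pi_pmf A False (\<lambda>i. bernoulli_pmf (p i)))"
  let ?s = "\<lambda>B. \<Sum>i\<in>A. of_bool (B i) :: nat"
  have "(\<integral>\<^sup>+B. 2 * g (?s B + 1) \<partial>?M) \<le> (\<integral>\<^sup>+B. g (?s B) + g (?s B + 2) \<partial>?M)"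
    by (intro nn_integral_mono assms)
  then show ?thesis
    unfolding bernoulli_sum_mean_def by (simp add: nn_integral_cmult nn_integral_add)
qed

text \<open>
  One smoothing step. The parameter \<open>p i < m\<close> is raised to \<open>m\<close> at the expense of \<open>p j > m\<close>; the
  product grows by \<open>(m - p i) (p j - m)\<close>.
\<close>

lemma bernoulli_sum_mean_smooth:
  assumes convex: "\<And>y. 2 * g (y + 1) \<le> g y + g (y + 2)"
    and A: "finite A" "i \<in> A" "j \<in> A"
    and p: "\<And>k. k \<in> A \<Longrightarrow> 0 \<le> p k \<and> p k \<le> 1"
    and m: "p i < m" "m < p j"
  shows "bernoulli_sum_mean g A p \<le> bernoulli_sum_mean g A (p(i := m, j := p i + p j - m))"
proof -
  define q where "q = p(i := m, j := p i + p j - m)"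
  define A' where "A' = A - {i, j}"
  have ij: "i \<noteq> j" using m by auto
  have A': "A = insert i (insert j A')" "i \<notin> insert j A'" "j \<notin> A'" "finite A'"
    using A ij by (auto simp: A'_def)
  have qk: "q i = m" "q j = p i + p j - m"
    using ij by (simp_all add: q_def)
  have bounds: "0 \<le> p i" "p i \<le> 1" "0 \<le> p j" "p j \<le> 1" "0 \<le> q i" "q i \<le> 1" "0 \<le> q j" "q j \<le> 1"
    using p[of i] p[of j] A m unfolding qk by auto
  have expand: "bernoulli_sum_mean g A r
      = ennreal (r i) * (ennreal (r j) * bernoulli_sum_mean (\<lambda>s. g (s + 2)) A' r
          + ennreal (1 - r j) * bernoulli_sum_mean (\<lambda>s. g (s + 1)) A' r)
      + ennreal (1 - r i) * (ennreal (r j) * bernoulli_sum_mean (\<lambda>s. g (s + 1)) A' r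
          + ennreal (1 - r j) * bernoulli_sum_mean g A' r)"
    if "0 \<le> r i" "r i \<le> 1" "0 \<le> r j" "r j \<le> 1" for r
    using A' that by (simp add: bernoulli_sum_mean_insert)
  have rest: "bernoulli_sum_mean h A' q = bernoulli_sum_mean h A' p" for h
    using A' by (intro bernoulli_sum_mean_cong) (auto simp: q_def)
  have "0 \<le> (m - p i) * (p j - m)"
    using m by simp
  then have prod: "p i * p j \<le> q i * q j"
    unfolding qk by (simp add: algebra_simps)
  show ?thesis
    unfolding q_def[symmetric] expand[OF bounds(1-4)] expand[OF bounds(5-8)] rest
    by (rule two_bernoulli_mean_mono[OF bernoulli_sum_mean_convex[OF convex] bounds _ prod])
      (simp add: qk)
qed

text \<open>Every smoothing step lowers the number of parameters that differ from the mean \<open>m\<close>.\<close>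

lemma bernoulli_sum_mean_le_equal:
  fixes m :: real
  assumes convex: "\<And>y. 2 * g (y + 1) \<le> g y + g (y + 2)"
    and A: "finite A"
    and "\<And>k. k \<in> A \<Longrightarrow> 0 \<le> p k \<and> p k \<le> 1"
    and "(\<Sum>k\<in>A. p k) = real (card A) * m"
  shows "bernoulli_sum_mean g A p \<le> bernoulli_sum_mean g A (\<lambda>_. m)"
  using assms(3,4)
proof (induction "card {k\<in>A. p k \<noteq> m}" arbitrary: p rule: less_induct)
  case less
  note p = less.prems(1) and sum = less.prems(2)
  have dev: "(\<Sum>k\<in>A. p k - m) = 0"
    using sum by (simp add: sum_subtractf)
  show ?case
  proof (cases "\<forall>k\<in>A. p k = m")
    case True
    then show ?thesis
      using bernoulli_sum_mean_cong[OF A, of p "\<lambda>_. m" g] by simp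
  next
    case False
    \<comment> \<open>The deviations from \<open>m\<close> sum to zero without all vanishing, so both signs occur.\<close>
    have "\<exists>i\<in>A. p i < m"
    proof (rule ccontr)
      assume "\<not> ?thesis"
      then have "\<forall>k\<in>A. p k - m = 0"
        using sum_nonneg_eq_0_iff[OF A, of "\<lambda>k. p k - m"] dev by (auto simp: not_less)
      then show False using False by auto
    qed
    then obtain i where i: "i \<in> A" "p i < m" by blast
    have "\<exists>j\<in>A. p j > m"
    proof (rule ccontr)
      assume "\<not> ?thesis"
      moreover have "(\<Sum>k\<in>A. m - p k) = 0"
        using sum by (simp add: sum_subtractf)
      ultimately have "\<forall>k\<in>A. m - p k = 0"
        using sum_nonneg_eq_0_iff[OF A, of "\<lambda>k. m - p k"] by (auto simp: not_less)
      then show False using False by auto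
    qed
    then obtain j where j: "j \<in> A" "m < p j" by blast
    define q where "q = p(i := m, j := p i + p j - m)"
    have ij: "i \<noteq> j" using i j by auto
    have q: "0 \<le> q k \<and> q k \<le> 1" if "k \<in> A" for k
      using p[OF that] p[OF i(1)] p[OF j(1)] i j by (auto simp: q_def)
    have split: "(\<Sum>k\<in>A. r k) = r i + r j + (\<Sum>k\<in>A - {i, j}. r k)" for r :: "'a \<Rightarrow> real"
    proof -
      have "A - {i, j} = A - {i} - {j}" by auto
      then show ?thesis
        using A i(1) j(1) ij by (simp add: sum.remove[of A i] sum.remove[of "A - {i}" j])
    qed
    have "(\<Sum>k\<in>A - {i, j}. q k) = (\<Sum>k\<in>A - {i, j}. p k)"
      by (intro sum.cong) (auto simp: q_def)
    then have sum_q: "(\<Sum>k\<in>A. q k) = real (card A) * m"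
      using sum ij unfolding split[of q] split[of p] by (simp add: q_def)
    have "{k\<in>A. q k \<noteq> m} \<subset> {k\<in>A. p k \<noteq> m}"
      using i j ij by (auto simp: q_def)
    then have card_less: "card {k\<in>A. q k \<noteq> m} < card {k\<in>A. p k \<noteq> m}"
      using A by (intro psubset_card_mono) auto
    have "bernoulli_sum_mean g A p \<le> bernoulli_sum_mean g A q"
      unfolding q_def using convex A p i j by (intro bernoulli_sum_mean_smooth) auto
    also have "\<dots> \<le> bernoulli_sum_mean g A (\<lambda>_. m)"
      using less.hyps[OF card_less q sum_q] .
    finally show ?thesis .
  qed
qed

section \<open>The maximum entropy property\<close>

lemma compound_mean_le_compound_binomial_mean:
  assumes convex: "\<And>x a b. f (x + a) + f (x + b) \<le> f x + f (x + a + b)"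
    and "n \<ge> 1" and p: "p \<in> success_vectors n lam"
  shows "(\<integral>\<^sup>+x. f x \<partial>measure_pmf (compound_pmf Q (bernoulli_sum_pmf n p)))
    \<le> (\<integral>\<^sup>+x. f x \<partial>measure_pmf (compound_binomial_pmf n (lam / real n) Q))"
proof -
  define g where "g y = (\<integral>\<^sup>+x. f x \<partial>measure_pmf (conv_power_pmf Q y))" for y
  have mean: "(\<integral>\<^sup>+x. f x \<partial>measure_pmf (compound_pmf Q (bernoulli_sum_pmf n r)))
      = bernoulli_sum_mean g {1..n} r" for r
    by (simp add: nn_integral_compound_pmf bernoulli_sum_pmf_def bernoulli_sum_mean_def g_def)
  have "bernoulli_sum_mean g {1..n} p \<le> bernoulli_sum_mean g {1..n} (\<lambda>_. lam / real n)"
  proof (rule bernoulli_sum_mean_le_equal)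
    show "2 * g (y + 1) \<le> g y + g (y + 2)" for y
      unfolding g_def by (rule compound_mean_convex[OF convex])
  qed (use p \<open>n \<ge> 1\<close> in \<open>auto simp: success_vectors_def\<close>)
  then show ?thesis
    by (simp add: mean compound_binomial_pmf_def)
qed

theorem theorem2p5:
  fixes n :: nat and lam :: real and Q :: "nat pmf"
  assumes "n \<ge> 1" and "0 < lam" and "lam \<le> real n"
    and "pmf Q 0 = 0"
    and "log_concave_pmf Q"
    and "log_concave_pmf (compound_binomial_pmf n (lam / real n) Q)"
    and "finite (set_pmf Q) \<or>
         (\<exists>\<rho> \<beta> :: real. \<exists>N0 :: nat. \<rho> > 0 \<and> \<beta> > 0 \<and> N0 \<ge> 1 \<and>
            (\<forall>x\<ge>N0. pmf Q x \<ge> \<rho> powr (real x powr \<beta>)))"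
  shows "pmf_entropy (compound_binomial_pmf n (lam / real n) Q)
           \<in> {pmf_entropy (compound_pmf Q (bernoulli_sum_pmf n p)) | p. p \<in> success_vectors n lam} \<and>
         (\<forall>h \<in> {pmf_entropy (compound_pmf Q (bernoulli_sum_pmf n p)) | p. p \<in> success_vectors n lam}.
            h \<le> pmf_entropy (compound_binomial_pmf n (lam / real n) Q))"
proof (intro conjI ballI)
  have "(\<lambda>_. lam / real n) \<in> success_vectors n lam"
    using assms(1-3) by (simp add: success_vectors_def)
  then show "pmf_entropy (compound_binomial_pmf n (lam / real n) Q)
      \<in> {pmf_entropy (compound_pmf Q (bernoulli_sum_pmf n p)) | p. p \<in> success_vectors n lam}"
    unfolding compound_binomial_pmf_def by blast
next
  let ?R = "compound_binomial_pmf n (lam / real n) Q"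
  fix h assume "h \<in> {pmf_entropy (compound_pmf Q (bernoulli_sum_pmf n p)) | p.
    p \<in> success_vectors n lam}"
  then obtain p where p: "p \<in> success_vectors n lam"
    and h: "h = pmf_entropy (compound_pmf Q (bernoulli_sum_pmf n p))"
    by blast
  have "h \<le> (\<integral>\<^sup>+x. neg_log_pmf ?R x \<partial>measure_pmf (compound_pmf Q (bernoulli_sum_pmf n p)))"
    unfolding h by (rule pmf_entropy_le_mean_neg_log)
  also have "\<dots> \<le> (\<integral>\<^sup>+x. neg_log_pmf ?R x \<partial>measure_pmf ?R)"
    by (rule compound_mean_le_compound_binomial_mean[OF neg_log_pmf_convex[OF assms(6)] assms(1) p])
  also have "\<dots> = pmf_entropy ?R"
    by (rule pmf_entropy_eq_mean_neg_log[symmetric])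
  finally show "h \<le> pmf_entropy ?R" .
qed

end
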